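(* For nonnegative integers $m<n$, let $\Phi(m,n)$ denote the number of subsets $A$ of $\{m+1,m+2,\ldots,n\}$ such that $\gcd(A)$ is relatively prime to $n$. Then \[ \Phi(m,n)=\sum_{d\mid n}\mu(d)\,2^{(n/d)-[m/d]}. \] Moreover, if $n\ge 2$ and $p^{*}$ is the smallest prime divisor of $n$, then \[ 0\le 2^{n-m}-2^{(n/p^{*})-[m/p^{*}]}-\Phi(m,n)\le 2n\,2^{[(n-m)/(p^{*}+1)]}. \]
   Context: Here subsets include the empty set, with the convention $\gcd(\emptyset)=0$ (so the empty set is counted exactly when $n=1$). $\mu$ denotes the Möbius function, and the sum runs over positive divisors $d$ of $n$. For a real number $x$, $[x]$ denotes the greatest integer not exceeding $x$. *)

theory Defs
  imports "HOL-Computational_Algebra.Computational_Algebra"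
begin

definition moebius :: "nat \<Rightarrow> int" where
  "moebius d = (if squarefree d then (-1) ^ card (prime_factors d) else 0)"

(* The empty set is a subset like any other here: Gcd {} = 0, so it is counted exactly when n = 1. *)
definition Phi :: "nat \<Rightarrow> nat \<Rightarrow> nat" where
  "Phi m n = card {A. A \<subseteq> {m+1..n} \<and> coprime (Gcd A) n}"

(* Only meaningful for n \<ge> 2. *)
definition least_prime_divisor :: "nat \<Rightarrow> nat" where
  "least_prime_divisor n = (LEAST p. prime p \<and> p dvd n)"

end

(* Moebius inversion over the divisors of gcd(gcd(A), n) reduces the formula to counting the sets
   of multiples of d in {m+1..n}. In the estimate, the quantity to be bounded counts the sets A
   contained in the multiples of some prime q dividing n, but not all contained in the multiples of
   the least such prime p; each of the at most n primes q > p contributes at most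
   2^(1 + [(n-m)/q]) sets. *)

theory Submission
  imports Defs
begin

text \<open>Lets \<open>prime_factors\<close> recover a set of primes from its product: one half of
  the bijection between squarefree divisors and sets of prime factors.\<close>

lemma prime_factorization_prod_primes:
  fixes S :: "nat set"
  assumes "finite S" "\<And>p. p \<in> S \<Longrightarrow> prime p"
  shows "prime_factorization (\<Prod>S) = mset_set S"
  using assms prime_factorization_prod_mset_primes[of "mset_set S"]
  by (simp add: prod_unfold_prod_mset)

text \<open>Every prime factor of a squarefree number has multiplicity one. This is the other half
  of the bijection: the product of the prime factors gives back the number.\<close>

lemma prime_factorization_squarefree:
  fixes d :: nat
  assumes "squarefree d"
  shows "prime_factorization d = mset_set (prime_factors d)"
proof (rule multiset_eqI)
  fix p
  have "d \<noteq> 0" using assms by (metis not_squarefree_0)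
  then show "count (prime_factorization d) p = count (mset_set (prime_factors d)) p"
    using assms squarefree_factorial_semiring'[of d]
    by (cases "p \<in> prime_factors d")
       (auto simp: count_prime_factorization_prime in_prime_factors_imp_prime
          simp flip: not_in_iff)
qed

text \<open>Expand the product of \<open>1 - 1\<close> over \<open>S\<close>: it is 0 unless
  \<open>S\<close> is empty.\<close>

lemma sum_minus_one_power_card_Pow:
  assumes "finite S"
  shows "(\<Sum>X\<in>Pow S. (-1 :: 'a :: comm_ring_1) ^ card X) = of_bool (S = {})"
  using prod_diff_conv_sum[OF assms, of "\<lambda>_. 1 :: 'a" "\<lambda>_. 1"] assms
  by (cases "S = {}") (simp_all add: power_0_left)

text \<open>Only squarefree divisors contribute, and they correspond to the subsets of
  \<open>prime_factors k\<close>. The resulting alternating sum vanishes unless \<open>k\<close> has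
  no prime factor.\<close>

lemma sum_moebius_divisors:
  assumes "k > 0"
  shows "(\<Sum>d | d dvd k. moebius d) = of_bool (k = 1)"
proof -
  have pf: "prime_factorization (\<Prod>S) = mset_set S" if "S \<subseteq> prime_factors k" for S
    using that by (intro prime_factorization_prod_primes) (auto intro: finite_subset)
  have "(\<Sum>d | d dvd k. moebius d) = (\<Sum>d | d dvd k \<and> squarefree d. moebius d)"
    using assms by (intro sum.mono_neutral_right) (auto simp: moebius_def)
  also have "\<dots> = (\<Sum>S\<in>Pow (prime_factors k). (-1) ^ card S)"
  proof (rule sum.reindex_bij_witness[where i = Prod and j = prime_factors])
    fix d assume d: "d \<in> {d. d dvd k \<and> squarefree d}"
    then have "d > 0" using assms by (auto intro: dvd_pos_nat)
    have "\<Prod>(prime_factors d) = prod_mset (prime_factorization d)"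
      using d by (subst prime_factorization_squarefree) (auto simp: prod_unfold_prod_mset)
    then show "\<Prod>(prime_factors d) = d"
      using \<open>d > 0\<close> by (simp add: prod_mset_prime_factorization_nat)
    show "prime_factors d \<in> Pow (prime_factors k)"
      using d assms dvd_prime_factors[of k d] by auto
    show "(-1) ^ card (prime_factors d) = moebius d"
      using d by (simp add: moebius_def)
  next
    fix S assume "S \<in> Pow (prime_factors k)"
    then have S: "S \<subseteq> prime_factors k" by simp
    then have fin: "finite S" by (auto intro: finite_subset)
    have pos: "\<Prod>S \<noteq> 0" using S fin by (auto dest: in_prime_factors_imp_prime)
    show "prime_factors (\<Prod>S) = S"
      using fin by (simp add: pf[OF S])
    \<comment> \<open>Each element of \<open>S\<close> has multiplicity 1 on the left and at least 1
      on the right; inclusion of factorizations is divisibility.\<close>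
    have "mset_set S \<subseteq># prime_factorization k"
      using S by (intro mset_subset_eqI) (auto simp: count_mset_set' Suc_le_eq)
    then have "\<Prod>S dvd k"
      using pf[OF S] pos assms by (simp add: prime_factorization_subset_iff_dvd[symmetric])
    moreover have "squarefree (\<Prod>S)"
      using S by (intro squarefree_prod_coprime)
        (auto intro: primes_coprime squarefree_prime dest: in_prime_factors_imp_prime)
    ultimately show "\<Prod>S \<in> {d. d dvd k \<and> squarefree d}" by simp
  qed
  also have "\<dots> = of_bool (k = 1)"
    using assms by (subst sum_minus_one_power_card_Pow)
      (auto simp: prime_factorization_empty_iff)
  finally show ?thesis .
qed

text \<open>The multiples are \<open>d * j\<close> with \<open>m div d < j\<close> and
  \<open>j \<le> n div d\<close>.\<close>

lemma card_multiples_Ioc: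
  fixes d m n :: nat
  assumes "d > 0"
  shows "card {k \<in> {m+1..n}. d dvd k} = n div d - m div d"
proof -
  have "{k \<in> {m+1..n}. d dvd k} = (\<lambda>j. d * j) ` {m div d + 1..n div d}"
  proof (intro equalityI subsetI)
    fix k assume "k \<in> {k \<in> {m+1..n}. d dvd k}"
    then obtain j where "k = d * j" "m < d * j" "d * j \<le> n" by auto
    then show "k \<in> (\<lambda>j. d * j) ` {m div d + 1..n div d}"
      using assms by (auto simp: div_less_iff_less_mult less_eq_div_iff_mult_less_eq
          mult.commute Suc_le_eq)
  qed (use assms in \<open>auto simp: div_less_iff_less_mult less_eq_div_iff_mult_less_eq
          mult.commute Suc_le_eq\<close>)
  then show ?thesis
    using assms by (simp add: card_image inj_on_def)
qed

lemma card_subsets_dvd_Gcd: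
  fixes d m n :: nat
  assumes "d > 0"
  shows "card {A. A \<subseteq> {m+1..n} \<and> d dvd Gcd A} = 2 ^ (n div d - m div d)"
proof -
  have "{A. A \<subseteq> {m+1..n} \<and> d dvd Gcd A} = Pow {k \<in> {m+1..n}. d dvd k}"
    by (auto simp: dvd_Gcd_iff)
  then show ?thesis
    by (simp only: card_Pow card_multiples_Ioc[OF assms] finite_Collect_conjI
        finite_atLeastAtMost Collect_mem_eq simp_thms)
qed

lemma Phi_eq_sum_moebius:
  assumes "n > 0"
  shows "int (Phi m n) = (\<Sum>d | d dvd n. moebius d * 2 ^ (n div d - m div d))"
proof -
  let ?I = "{m+1..n}"
  have fin: "finite {d. d dvd n}" using assms by simp
  have "int (Phi m n) = (\<Sum>A\<in>Pow ?I. of_bool (coprime (Gcd A) n))"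
    by (simp add: Phi_def sum.If_cases of_bool_def Int_def Pow_def)
  also have "\<dots> = (\<Sum>A\<in>Pow ?I. \<Sum>d | d \<in> {d. d dvd n} \<and> d dvd Gcd A. moebius d)"
  proof (rule sum.cong[OF refl])
    fix A
    \<comment> \<open>As \<open>n > 0\<close>, this gcd is positive even for \<open>A = {}\<close>,
      where \<open>Gcd A = 0\<close>, so \<open>sum_moebius_divisors\<close> applies to it.\<close>
    have "{d. d \<in> {d. d dvd n} \<and> d dvd Gcd A} = {d. d dvd gcd (Gcd A) n}" by auto
    then show "of_bool (coprime (Gcd A) n) =
        (\<Sum>d | d \<in> {d. d dvd n} \<and> d dvd Gcd A. moebius d)"
      using assms sum_moebius_divisors[of "gcd (Gcd A) n"] by (simp add: coprime_iff_gcd_eq_1)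
  qed
  also have "\<dots> = (\<Sum>d | d dvd n. \<Sum>A | A \<in> Pow ?I \<and> d dvd Gcd A. moebius d)"
    by (rule sum.swap_restrict) (use fin in auto)
  also have "\<dots> = (\<Sum>d | d dvd n. moebius d * 2 ^ (n div d - m div d))"
    using assms card_subsets_dvd_Gcd
    by (intro sum.cong) (auto simp: mult.commute dvd_pos_nat)
  finally show ?thesis .
qed

lemma least_prime_divisor_props:
  assumes "n \<ge> 2"
  shows "prime (least_prime_divisor n)" "least_prime_divisor n dvd n"
    and "\<And>q. prime q \<Longrightarrow> q dvd n \<Longrightarrow> least_prime_divisor n \<le> q"
proof -
  obtain p where "prime p \<and> p dvd n"
    using assms prime_factor_nat[of n] by auto
  then show "prime (least_prime_divisor n)" "least_prime_divisor n dvd n"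
    unfolding least_prime_divisor_def by (metis (mono_tags, lifting) LeastI)+
  show "\<And>q. prime q \<Longrightarrow> q dvd n \<Longrightarrow> least_prime_divisor n \<le> q"
    unfolding least_prime_divisor_def by (simp add: Least_le)
qed

text \<open>Write \<open>n\<close> as \<open>m + (n - m)\<close>: adding the two remainders modulo
  \<open>q\<close> carries at most 1, and replacing \<open>q\<close> by the smaller \<open>p\<close>
  can only increase the quotient.\<close>

lemma div_diff_le_div_diff_Suc:
  fixes m n p q :: nat
  assumes "m \<le> n" "0 < p" "p \<le> q"
  shows "n div q - m div q \<le> (n - m) div p + 1"
proof -
  have "n div q = m div q + (n - m) div q + (m mod q + (n - m) mod q) div q"
    using div_add1_eq[of m "n - m" q] assms by simp
  moreover have "(m mod q + (n - m) mod q) div q < 2"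
    using assms mod_less_divisor[of q m] mod_less_divisor[of q "n - m"]
    by (subst div_less_iff_less_mult) linarith+
  moreover have "(n - m) div q \<le> (n - m) div p"
    using assms by (simp add: div_le_mono2)
  ultimately show ?thesis by linarith
qed

lemma Phi_defect_bounds:
  fixes m n :: nat
  assumes "m < n" "n \<ge> 2"
  defines "p \<equiv> least_prime_divisor n"
  defines "\<Delta> \<equiv> (2::int) ^ (n - m) - 2 ^ (n div p - m div p) - int (Phi m n)"
  shows "0 \<le> \<Delta>" and "\<Delta> \<le> 2 * int n * 2 ^ ((n - m) div (p + 1))"
proof -
  let ?I = "{m+1..n}"
  \<comment> \<open>\<open>N\<close> collects the sets that \<open>Phi\<close> leaves out,
    \<open>B q\<close> the sets of multiples of \<open>q\<close>, and \<open>Q\<close> the prime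
    divisors of \<open>n\<close> other than the least.\<close>
  define B where "B q = {A. A \<subseteq> ?I \<and> q dvd Gcd A}" for q
  define N where "N = {A. A \<subseteq> ?I \<and> \<not> coprime (Gcd A) n}"
  define Q where "Q = prime_factors n - {p}"
  note p = least_prime_divisor_props[OF assms(2), folded p_def]
  have fin: "finite N" "finite (B q)" for q
    unfolding N_def B_def by (auto intro: finite_subset[of _ "Pow ?I"])
  have "Phi m n + card N = card (Pow ?I)"
    unfolding Phi_def N_def
    by (subst card_Un_disjoint[symmetric])
       (auto intro: finite_subset[of _ "Pow ?I"] arg_cong[where f = card])
  then have total: "Phi m n + card N = 2 ^ (n - m)"
    by (simp add: card_Pow)
  have card_B: "card (B q) = 2 ^ (n div q - m div q)" if "q > 0" for q
    unfolding B_def using that by (rule card_subsets_dvd_Gcd)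
  have BN: "B p \<subseteq> N"
    using p not_prime_unit by (auto simp: B_def N_def dest: coprime_common_divisor)
  \<comment> \<open>Being a cardinality, \<open>\<Delta>\<close> is nonnegative, and an upper bound
    can come from a covering of \<open>N - B p\<close>.\<close>
  have \<Delta>: "\<Delta> = int (card (N - B p))"
  proof -
    have "card (N - B p) + card (B p) = card N"
      using BN fin by (metis card_Diff_subset card_mono le_add_diff_inverse2)
    then have "int (card (N - B p)) = int (card N) - 2 ^ (n div p - m div p)"
      using card_B[of p] p(1) prime_gt_0_nat[of p] by (metis add_diff_cancel_right' of_nat_add
          of_nat_numeral of_nat_power)
    moreover have "int (Phi m n) + int (card N) = 2 ^ (n - m)"
      using arg_cong[OF total, of int] by simp
    ultimately show ?thesis by (simp add: \<Delta>_def)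
  qed
  then show "0 \<le> \<Delta>" by simp
  \<comment> \<open>Some prime \<open>q\<close> divides both \<open>Gcd A\<close> and
    \<open>n\<close>; it differs from \<open>p\<close> because \<open>A\<close> is not in
    \<open>B p\<close>.\<close>
  have "N - B p \<subseteq> (\<Union>q\<in>Q. B q)"
  proof
    fix A assume A: "A \<in> N - B p"
    then have "gcd (Gcd A) n \<noteq> 1" by (auto simp: N_def coprime_iff_gcd_eq_1)
    then obtain q where "prime q" "q dvd gcd (Gcd A) n" using prime_factor_nat by blast
    then show "A \<in> (\<Union>q\<in>Q. B q)"
      using A assms(2) by (auto simp: Q_def B_def N_def in_prime_factors_iff)
  qed
  then have "card (N - B p) \<le> card (\<Union>q\<in>Q. B q)"
    using fin by (intro card_mono) (auto simp: Q_def)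
  also have "\<dots> \<le> (\<Sum>q\<in>Q. card (B q))"
    by (rule card_UN_le) (simp add: Q_def)
  also have "\<dots> \<le> (\<Sum>q\<in>Q. 2 * 2 ^ ((n - m) div (p + 1)))"
  proof (rule sum_mono)
    fix q assume "q \<in> Q"
    then have q: "prime q" "q dvd n" "q \<noteq> p" by (auto simp: Q_def)
    \<comment> \<open>Minimality of \<open>p\<close> yields the divisor \<open>p + 1\<close> of the
      bound; the carry of 1 in the exponent yields a factor 2.\<close>
    then have "p + 1 \<le> q" using p(3)[of q] by simp
    then have "n div q - m div q \<le> (n - m) div (p + 1) + 1"
      using assms(1) by (intro div_diff_le_div_diff_Suc) auto
    then have "(2::nat) ^ (n div q - m div q) \<le> 2 ^ ((n - m) div (p + 1) + 1)"
      by (rule power_increasing) simp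
    then show "card (B q) \<le> 2 * 2 ^ ((n - m) div (p + 1))"
      using card_B[of q] q prime_gt_0_nat by simp
  qed
  also have "\<dots> = card Q * (2 * 2 ^ ((n - m) div (p + 1)))" by simp
  also have "\<dots> \<le> n * (2 * 2 ^ ((n - m) div (p + 1)))"
  proof (rule mult_right_mono)
    \<comment> \<open>A crude count suffices: the factor \<open>n\<close> in the bound only reflects
      that prime divisors of \<open>n\<close> are at most \<open>n\<close>.\<close>
    have "Q \<subseteq> {1..n}"
      using assms(2) by (auto simp: Q_def in_prime_factors_iff Suc_le_eq prime_gt_0_nat
          dvd_imp_le)
    from card_mono[OF _ this] show "card Q \<le> n" by simp
  qed simp
  finally have "int (card (N - B p)) \<le> int (n * (2 * 2 ^ ((n - m) div (p + 1))))"
    by (simp only: of_nat_le_iff)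
  then show "\<Delta> \<le> 2 * int n * 2 ^ ((n - m) div (p + 1))"
    by (simp add: \<Delta> mult_ac)
qed

(* On natural numbers, m div d is the integer part of m/d. For d dvd n and m < n we have
   m div d \<le> n div d, so the truncated subtractions in the exponents are exact. *)
theorem theorem3:
  fixes m n :: nat
  assumes "m < n"
  shows "int (Phi m n) = (\<Sum>d | d dvd n. moebius d * 2 ^ (n div d - m div d))
    \<and> (n \<ge> 2 \<longrightarrow>
         (let p = least_prime_divisor n;
              \<Delta> = (2::int) ^ (n - m) - 2 ^ (n div p - m div p) - int (Phi m n)
          in 0 \<le> \<Delta> \<and> \<Delta> \<le> 2 * int n * 2 ^ ((n - m) div (p + 1))))"
  using Phi_eq_sum_moebius[of n m] Phi_defect_bounds[OF assms] assms
  by (simp add: Let_def)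

end
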